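(* For every integer $q\ge 0$, the Casimir elements $\hat c_0,\hat c_1,\hat c_2,\dots$ of $U(\mathfrak{so}(n,\mathbb C))$ satisfy $$2\hat c_{2q+1}=-\hat c_{2q}+\sum_{p=0}^{2q}(-1)^p\hat c_{2q-p}\,\hat c_p .$$
   Context: Let $n\ge 2$ and let $\{e_i\}_{i=1}^n$ be the standard basis of $\mathbb R^n$. The Lie algebra $\mathfrak{so}(n)$ is spanned by $e_{ij}:=e_i\wedge e_j$ acting on $\mathbb R^n$ by $e_{ij}(u)=\langle e_i,u\rangle e_j-\langle e_j,u\rangle e_i$. Thus $e_{ij}=-e_{ji}$, $e_{ii}=0$, $[e_{kl},e_{ij}]=\delta_{ki}e_{lj}+\delta_{kj}e_{il}-\delta_{il}e_{kj}-\delta_{lj}e_{ik}$. $U(\mathfrak{so}(n,\mathbb C))$ is the universal enveloping algebra of the complexification $\mathfrak{so}(n,\mathbb C)$, and elements of its center are called Casimir elements. In $U(\mathfrak{so}(n,\mathbb C))$ put $\hat e_{ij}:=e_{ij}+\frac{n-1}{2}\delta_{ij}$, $\hat e_{ij}^0:=\delta_{ij}$, and for $q\ge1$, $\hat e_{ij}^q:=\sum_{1\le i_1,\dots,i_{q-1}\le n}\hat e_{ii_1}\hat e_{i_1i_2}\cdots\hat e_{i_{q-1}j}$. Put $\hat c_q:=\sum_{i}\hat e_{ii}^q$, which is central. *)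

theory Defs
  imports "HOL-Analysis.Analysis" "HOL-Library.Poly_Mapping"
begin

section \<open>Complex Lie algebras\<close>

class complex_lie_algebra = ab_group_add +
  fixes cscale :: "complex \<Rightarrow> 'a \<Rightarrow> 'a"  (infixr "*\<^sub>L" 75)
    and lie :: "'a \<Rightarrow> 'a \<Rightarrow> 'a"
  assumes cscale_add_right: "c *\<^sub>L (x + y) = c *\<^sub>L x + c *\<^sub>L y"
    and cscale_add_left: "(c + d) *\<^sub>L x = c *\<^sub>L x + d *\<^sub>L x"
    and cscale_cscale: "c *\<^sub>L d *\<^sub>L x = (c * d) *\<^sub>L x"
    and cscale_one: "1 *\<^sub>L x = x"
    and lie_add_left: "lie (x + y) z = lie x z + lie y z"
    and lie_add_right: "lie x (y + z) = lie x y + lie x z"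
    and lie_cscale_left: "lie (c *\<^sub>L x) y = c *\<^sub>L lie x y"
    and lie_cscale_right: "lie x (c *\<^sub>L y) = c *\<^sub>L lie x y"
    and lie_self: "lie x x = 0"
    and jacobi: "lie x (lie y z) + lie y (lie z x) + lie z (lie x y) = 0"


section \<open>The universal enveloping algebra\<close>

datatype 'a word = Word "'a list"

instantiation word :: (type) monoid_add
begin

definition zero_word :: "'a word" where "0 = Word []"

fun plus_word :: "'a word \<Rightarrow> 'a word \<Rightarrow> 'a word" where
  "Word xs + Word ys = Word (xs @ ys)"

instance
proof
  fix a b c :: "'a word"
  show "a + b + c = a + (b + c)" by (cases a; cases b; cases c) simp
  show "0 + a = a" by (cases a) (simp add: zero_word_def)
  show "a + 0 = a" by (cases a) (simp add: zero_word_def)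
qed

end

text \<open>
  The monoid algebra of the free monoid on the \<^emph>\<open>set\<close> underlying a Lie algebra \<open>g\<close> is the free
  associative unital algebra on that set.  Dividing it by the two-sided ideal generated by the
  linearity relations yields the tensor algebra \<open>T(g)\<close>; dividing further by
  \<open>x \<otimes> y - y \<otimes> x - [x, y]\<close> yields \<open>U(g)\<close>.  Both families of relations are imposed at once.
\<close>

type_synonym 'g free_alg = "'g word \<Rightarrow>\<^sub>0 complex"

definition free_scalar :: "complex \<Rightarrow> 'g free_alg" where
  "free_scalar c = Poly_Mapping.single 0 c"

definition free_gen :: "'g \<Rightarrow> 'g free_alg" where
  "free_gen x = Poly_Mapping.single (Word [x]) 1"

inductive_set uea_relators :: "'g::complex_lie_algebra free_alg set" where
  rel_add: "free_gen (x + y) - free_gen x - free_gen y \<in> uea_relators"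
| rel_cscale: "free_gen (c *\<^sub>L x) - free_scalar c * free_gen x \<in> uea_relators"
| rel_lie: "free_gen x * free_gen y - free_gen y * free_gen x - free_gen (lie x y)
             \<in> uea_relators"

inductive_set uea_ideal :: "'g::complex_lie_algebra free_alg set" where
  ideal_zero: "0 \<in> uea_ideal"
| ideal_gen: "r \<in> uea_relators \<Longrightarrow> a * r * b \<in> uea_ideal"
| ideal_add: "s \<in> uea_ideal \<Longrightarrow> t \<in> uea_ideal \<Longrightarrow> s + t \<in> uea_ideal"

lemma ideal_mult: "s \<in> uea_ideal \<Longrightarrow> a * s * b \<in> uea_ideal"
proof (induction rule: uea_ideal.induct)
  case (ideal_gen r c d)
  have "a * (c * r * d) * b = (a * c) * r * (d * b)" by (simp add: mult.assoc)
  then show ?case using uea_ideal.ideal_gen[OF ideal_gen] by metis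
next
  case (ideal_add s t)
  then show ?case by (simp add: distrib_left distrib_right uea_ideal.ideal_add)
qed (simp add: uea_ideal.ideal_zero)

lemma ideal_mult_left: "s \<in> uea_ideal \<Longrightarrow> a * s \<in> uea_ideal"
  using ideal_mult[of s a 1] by simp

lemma ideal_mult_right: "s \<in> uea_ideal \<Longrightarrow> s * b \<in> uea_ideal"
  using ideal_mult[of s 1 b] by simp

lemma ideal_minus: "s \<in> uea_ideal \<Longrightarrow> - s \<in> uea_ideal"
  using ideal_mult_left[of s "- 1"] by simp

definition uea_rel :: "'g::complex_lie_algebra free_alg \<Rightarrow> 'g free_alg \<Rightarrow> bool" where
  "uea_rel a b \<longleftrightarrow> a - b \<in> uea_ideal"

lemma equivp_uea_rel:
  "equivp (uea_rel :: 'a::complex_lie_algebra free_alg \<Rightarrow> 'a free_alg \<Rightarrow> bool)"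
proof (rule equivpI)
  show "reflp (uea_rel :: 'a free_alg \<Rightarrow> 'a free_alg \<Rightarrow> bool)"
    by (simp add: reflp_def uea_rel_def ideal_zero)
  show "symp (uea_rel :: 'a free_alg \<Rightarrow> 'a free_alg \<Rightarrow> bool)"
  proof (rule sympI)
    fix a b :: "'a free_alg"
    assume "uea_rel a b"
    then show "uea_rel b a" using ideal_minus[of "a - b"] by (simp add: uea_rel_def)
  qed
  show "transp (uea_rel :: 'a free_alg \<Rightarrow> 'a free_alg \<Rightarrow> bool)"
  proof (rule transpI)
    fix a b c :: "'a free_alg"
    assume "uea_rel a b" "uea_rel b c"
    then show "uea_rel a c" using ideal_add[of "a - b" "b - c"] by (simp add: uea_rel_def)
  qed
qed

lemma uea_rel_refl: "uea_rel a a"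
  by (simp add: uea_rel_def ideal_zero)

quotient_type (overloaded) 'g uea = "'g::complex_lie_algebra free_alg" / uea_rel
  by (rule equivp_uea_rel)

text \<open>The augmentation of the free algebra annihilates the ideal; hence \<open>U(g)\<close> is nontrivial.\<close>

lemma augmentation_mult:
  fixes f g :: "'g free_alg"
  shows "Poly_Mapping.lookup (f * g) 0 = Poly_Mapping.lookup f 0 * Poly_Mapping.lookup g 0"
proof -
  have w: "0 = l + q \<longleftrightarrow> l = 0 \<and> q = 0" for l q :: "'g word"
    by (cases l; cases q) (auto simp: zero_word_def)
  have "(\<Sum>q. Poly_Mapping.lookup g q when (0 = l + q))
      = (Poly_Mapping.lookup g 0 when (l = 0))" for l :: "'g word"
    unfolding w by (cases "l = 0") (simp_all add: when_def[of _ False])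
  then show ?thesis
    by (simp add: lookup_mult mult_when)
qed

lemma augmentation_ideal: "s \<in> uea_ideal \<Longrightarrow> Poly_Mapping.lookup s 0 = 0"
proof (induction rule: uea_ideal.induct)
  case (ideal_gen r a b)
  have "Poly_Mapping.lookup (free_gen x) 0 = 0" for x :: 'a
    by (simp add: free_gen_def lookup_single zero_word_def)
  with ideal_gen have "Poly_Mapping.lookup r 0 = 0"
    by cases (simp_all add: augmentation_mult lookup_minus)
  then show ?case by (simp add: augmentation_mult)
qed (simp_all add: lookup_add)

instantiation uea :: (complex_lie_algebra) ring_1
begin

lift_definition zero_uea :: "'a uea" is 0 .
lift_definition one_uea :: "'a uea" is 1 .

lift_definition plus_uea :: "'a uea \<Rightarrow> 'a uea \<Rightarrow> 'a uea" is "(+)"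
proof -
  fix a a' b b' :: "'a free_alg"
  assume "uea_rel a a'" "uea_rel b b'"
  then have "(a - a') + (b - b') \<in> uea_ideal"
    unfolding uea_rel_def by (rule ideal_add)
  then show "uea_rel (a + b) (a' + b')"
    by (simp add: uea_rel_def algebra_simps)
qed

lift_definition uminus_uea :: "'a uea \<Rightarrow> 'a uea" is uminus
proof -
  fix a a' :: "'a free_alg"
  assume "uea_rel a a'"
  then have "- (a - a') \<in> uea_ideal"
    unfolding uea_rel_def by (rule ideal_minus)
  then show "uea_rel (- a) (- a')"
    by (simp add: uea_rel_def)
qed

lift_definition minus_uea :: "'a uea \<Rightarrow> 'a uea \<Rightarrow> 'a uea" is "(-)"
proof -
  fix a a' b b' :: "'a free_alg"
  assume "uea_rel a a'" "uea_rel b b'"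
  then have "(a - a') + - (b - b') \<in> uea_ideal"
    unfolding uea_rel_def by (intro ideal_add ideal_minus)
  then show "uea_rel (a - b) (a' - b')"
    by (simp add: uea_rel_def algebra_simps)
qed

lift_definition times_uea :: "'a uea \<Rightarrow> 'a uea \<Rightarrow> 'a uea" is "(*)"
proof -
  fix a a' b b' :: "'a free_alg"
  assume "uea_rel a a'" "uea_rel b b'"
  then have "(a - a') * b + a' * (b - b') \<in> uea_ideal"
    unfolding uea_rel_def by (intro ideal_add ideal_mult_left ideal_mult_right)
  then show "uea_rel (a * b) (a' * b')"
    by (simp add: uea_rel_def algebra_simps)
qed

instance
proof
  show "(0::'a uea) \<noteq> 1"
  proof (transfer, rule notI)
    assume "uea_rel (0::'a free_alg) 1"
    from augmentation_ideal[OF this[unfolded uea_rel_def]] show False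
      by (simp add: lookup_minus lookup_one)
  qed
qed (transfer, simp add: algebra_simps uea_rel_refl)+

end

lift_definition uea_scalar :: "complex \<Rightarrow> 'g::complex_lie_algebra uea" is free_scalar .

lift_definition uea_incl :: "'g::complex_lie_algebra \<Rightarrow> 'g uea" is free_gen .

lemma uea_scalar_hom:
  "uea_scalar 0 = 0" "uea_scalar 1 = 1"
  "uea_scalar (c + d) = uea_scalar c + uea_scalar d"
  "uea_scalar (c * d) = uea_scalar c * uea_scalar d"
  by (transfer, simp add: free_scalar_def single_add mult_single uea_rel_refl)+

lemma uea_scalar_commute: "uea_scalar c * u = u * uea_scalar c"
proof (transfer fixing: c)
  fix a :: "'a free_alg"
  have "free_scalar c * a = a * free_scalar c"
  proof (induction a rule: update_induct)
    case const
    show ?case by simp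
  next
    case (update f w b)
    have "Poly_Mapping.update w b f = f + Poly_Mapping.single w b"
      using update.hyps
      by (intro poly_mapping_eqI)
        (auto simp: lookup_update lookup_add lookup_single in_keys_iff when_def)
    with update show ?case
      by (simp add: free_scalar_def mult_single distrib_left distrib_right mult.commute)
  qed
  then show "uea_rel (free_scalar c * a) (a * free_scalar c)"
    by (simp add: uea_rel_def ideal_zero)
qed

lemma uea_incl_add: "uea_incl (x + y) = uea_incl x + uea_incl y"
  using uea_ideal.ideal_gen[OF rel_add, of 1 x y 1]
  by transfer (simp add: uea_rel_def diff_diff_eq)

lemma uea_incl_cscale: "uea_incl (c *\<^sub>L x) = uea_scalar c * uea_incl x"
  using uea_ideal.ideal_gen[OF rel_cscale, of 1 c x 1]
  by transfer (simp add: uea_rel_def)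

lemma uea_incl_lie:
  "uea_incl (lie x y) = uea_incl x * uea_incl y - uea_incl y * uea_incl x"
proof -
  have "uea_incl x * uea_incl y - uea_incl y * uea_incl x = uea_incl (lie x y)"
    using uea_ideal.ideal_gen[OF rel_lie, of 1 x y 1]
    by transfer (simp add: uea_rel_def)
  then show ?thesis ..
qed


section \<open>The Lie algebra \<open>so(n, \<complex>)\<close>\<close>

text \<open>
  The complexification of the real skew-symmetric matrices, realised as the complex
  skew-symmetric matrices under the commutator.  The dimension \<open>n\<close> is \<open>CARD('n)\<close>.
\<close>

typedef 'n so_complex = "{A :: complex ^ 'n ^ 'n. transpose A = - A}"
  by (rule exI[of _ 0]) (simp add: transpose_def vec_eq_iff)

setup_lifting type_definition_so_complex

lemma transpose_linear:
  fixes A B :: "complex ^ 'n ^ 'n"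
  shows "transpose 0 = (0 :: complex ^ 'n ^ 'n)"
    and "transpose (A + B) = transpose A + transpose B"
    and "transpose (- A) = - transpose A"
    and "transpose (A - B) = transpose A - transpose B"
    and "transpose (\<chi> i j. c * A $ i $ j) = (\<chi> i j. c * transpose A $ i $ j)"
  by (simp_all add: transpose_def vec_eq_iff)

instantiation so_complex :: (finite) complex_lie_algebra
begin

lift_definition zero_so_complex :: "'a so_complex" is 0
  by (simp add: transpose_linear)
lift_definition plus_so_complex :: "'a so_complex \<Rightarrow> 'a so_complex \<Rightarrow> 'a so_complex" is "(+)"
  by (simp add: transpose_linear)
lift_definition uminus_so_complex :: "'a so_complex \<Rightarrow> 'a so_complex" is uminus
  by (simp add: transpose_linear)
lift_definition minus_so_complex :: "'a so_complex \<Rightarrow> 'a so_complex \<Rightarrow> 'a so_complex" is "(-)"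
  by (simp add: transpose_linear)
lift_definition cscale_so_complex :: "complex \<Rightarrow> 'a so_complex \<Rightarrow> 'a so_complex"
  is "\<lambda>c A. \<chi> i j. c * A $ i $ j"
  unfolding mem_Collect_eq transpose_linear by (simp add: vec_eq_iff)
lift_definition lie_so_complex :: "'a so_complex \<Rightarrow> 'a so_complex \<Rightarrow> 'a so_complex"
  is "\<lambda>A B. A ** B - B ** A"
proof -
  fix A B :: "complex ^ 'a ^ 'a"
  assume A: "transpose A = - A" and B: "transpose B = - B"
  have m: "(- X) ** (- Y) = X ** Y" for X Y :: "complex ^ 'a ^ 'a"
    by (simp add: matrix_matrix_mult_def vec_eq_iff)
  show "transpose (A ** B - B ** A) = - (A ** B - B ** A)"
    by (simp add: transpose_linear matrix_transpose_mul A B m)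
qed

instance
proof
  have l: "(X - Y) ** Z = X ** Z - Y ** Z" and r: "Z ** (X - Y) = Z ** X - Z ** Y"
    and la: "(X + Y) ** Z = X ** Z + Y ** Z" and ra: "Z ** (X + Y) = Z ** X + Z ** Y"
    for X Y Z :: "complex ^ 'a ^ 'a"
    by (simp_all add: matrix_matrix_mult_def vec_eq_iff left_diff_distrib right_diff_distrib
        distrib_left distrib_right sum.distrib sum_subtractf)
  have c: "(\<chi> i j. c * X $ i $ j) ** Y = (\<chi> i j. c * (X ** Y) $ i $ j)"
    "X ** (\<chi> i j. c * Y $ i $ j) = (\<chi> i j. c * (X ** Y) $ i $ j)"
    for c and X Y :: "complex ^ 'a ^ 'a"
    by (simp_all add: matrix_matrix_mult_def vec_eq_iff sum_distrib_left ac_simps)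
  have d: "(\<chi> i j. c * (X - Y) $ i $ j) = (\<chi> i j. c * X $ i $ j) - (\<chi> i j. c * Y $ i $ j)"
    "(\<chi> i j. c * (X + Y) $ i $ j) = (\<chi> i j. c * X $ i $ j) + (\<chi> i j. c * Y $ i $ j)"
    "(\<chi> i j. (b + c) * X $ i $ j) = (\<chi> i j. b * X $ i $ j) + (\<chi> i j. c * X $ i $ j)"
    "(\<chi> i j. 1 * X $ i $ j) = X"
    for b c and X Y :: "complex ^ 'a ^ 'a"
    by (simp_all add: vec_eq_iff algebra_simps)
  fix x y z :: "'a so_complex" and c d :: complex
  show "lie (x + y) z = lie x z + lie y z" "lie x (y + z) = lie x y + lie x z"
    by (transfer, simp add: la ra)+
  show "lie (c *\<^sub>L x) y = c *\<^sub>L lie x y" "lie x (c *\<^sub>L y) = c *\<^sub>L lie x y"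
    by (transfer, simp only: c d)+
  show "lie x (lie y z) + lie y (lie z x) + lie z (lie x y) = 0"
    by transfer (simp add: l r matrix_mul_assoc)
  show "c *\<^sub>L (x + y) = c *\<^sub>L x + c *\<^sub>L y" "(c + d) *\<^sub>L x = c *\<^sub>L x + d *\<^sub>L x" "1 *\<^sub>L x = x"
    by (transfer, simp only: d)+
  show "c *\<^sub>L d *\<^sub>L x = (c * d) *\<^sub>L x"
    by transfer (simp add: mult.assoc)
qed (transfer; simp)+

end

text \<open>
  The matrix of \<open>u \<mapsto> \<langle>e\<^sub>i, u\<rangle> e\<^sub>j - \<langle>e\<^sub>j, u\<rangle> e\<^sub>i\<close>, the pairing being extended
  complex bilinearly.
\<close>

lift_definition so_e :: "'n::finite \<Rightarrow> 'n \<Rightarrow> 'n so_complex"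
  is "\<lambda>i j. matrix (\<lambda>u. (u $ i) *s axis j 1 - (u $ j) *s axis i 1)"
  by (auto simp: matrix_def transpose_def vec_eq_iff axis_def)

lemma so_e_action:
  "Rep_so_complex (so_e i j) *v u = (u $ i) *s axis j 1 - (u $ j) *s axis i 1"
  by transfer
    (simp add: matrix_def matrix_vector_mult_def vec_eq_iff axis_def left_diff_distrib
      sum_subtractf if_distrib[of "\<lambda>x. x * _"] cong: if_cong)

lemma so_complex_eqI:
  assumes "\<And>u. Rep_so_complex A *v u = Rep_so_complex B *v u"
  shows "A = B"
  using assms by (simp add: matrix_eq flip: Rep_so_complex_inject)

lemma Rep_so_complex_diff_action:
  "Rep_so_complex (A - B) *v u = Rep_so_complex A *v u - Rep_so_complex B *v u"
  by (simp add: minus_so_complex.rep_eq matrix_vector_mult_diff_rdistrib)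

lemma Rep_so_complex_add_action:
  "Rep_so_complex (A + B) *v u = Rep_so_complex A *v u + Rep_so_complex B *v u"
  by (simp add: plus_so_complex.rep_eq matrix_vector_mult_add_rdistrib)

lemma Rep_so_complex_cscale_action:
  "Rep_so_complex (c *\<^sub>L A) *v u = c *s (Rep_so_complex A *v u)"
  by (simp add: cscale_so_complex.rep_eq matrix_vector_mult_def vec_eq_iff sum_distrib_left
      mult.assoc)

lemma Rep_so_complex_lie_action:
  "Rep_so_complex (lie A B) *v u =
     Rep_so_complex A *v (Rep_so_complex B *v u) - Rep_so_complex B *v (Rep_so_complex A *v u)"
  by (simp add: lie_so_complex.rep_eq matrix_vector_mul_assoc matrix_vector_mult_diff_rdistrib)

lemma so_e_bracket:
  "lie (so_e k l) (so_e i j) =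
     (if k = i then 1 else 0) *\<^sub>L so_e l j + (if k = j then 1 else 0) *\<^sub>L so_e i l
     - (if i = l then 1 else 0) *\<^sub>L so_e k j - (if l = j then 1 else 0) *\<^sub>L so_e i k"
  by (rule so_complex_eqI)
    (simp add: Rep_so_complex_diff_action Rep_so_complex_add_action Rep_so_complex_cscale_action
      Rep_so_complex_lie_action so_e_action vec_eq_iff axis_def)

lemma so_e_span: "A = (\<Sum>i\<in>UNIV. \<Sum>j\<in>UNIV. (Rep_so_complex A $ j $ i / 2) *\<^sub>L so_e i j)"
proof -
  have sum: "Rep_so_complex (\<Sum>x\<in>X. f x) $ a $ b = (\<Sum>x\<in>X. Rep_so_complex (f x) $ a $ b)"
    for X :: "'b set" and f :: "'b \<Rightarrow> 'a so_complex" and a b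
    by (induction X rule: infinite_finite_induct)
      (simp_all add: zero_so_complex.rep_eq plus_so_complex.rep_eq)
  have skew: "Rep_so_complex A $ b $ a = - Rep_so_complex A $ a $ b" for a b
  proof -
    have "transpose (Rep_so_complex A) $ a $ b = (- Rep_so_complex A) $ a $ b"
      using Rep_so_complex[of A] by simp
    then show ?thesis by (simp add: transpose_def)
  qed
  have entry: "Rep_so_complex (so_e i j) $ a $ b =
      (if b = i then if a = j then 1 else 0 else 0) - (if b = j then if a = i then 1 else 0 else 0)"
    for i j a b :: 'a
    by (simp add: so_e.rep_eq matrix_def axis_def)
  have expand: "Rep_so_complex A $ a $ b =
      (\<Sum>i\<in>UNIV. \<Sum>j\<in>UNIV. Rep_so_complex A $ j $ i / 2 * Rep_so_complex (so_e i j) $ a $ b)"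
    for a b
  proof -
    have "(\<Sum>i\<in>UNIV. \<Sum>j\<in>UNIV. Rep_so_complex A $ j $ i / 2 * Rep_so_complex (so_e i j) $ a $ b)
      = (\<Sum>i\<in>UNIV. \<Sum>j\<in>UNIV.
          if b = i then if a = j then Rep_so_complex A $ j $ i / 2 else 0 else 0)
      - (\<Sum>i\<in>UNIV. \<Sum>j\<in>UNIV. if b = j then if a = i then Rep_so_complex A $ j $ i / 2 else 0 else 0)"
      unfolding sum_subtractf[symmetric] by (intro sum.cong refl) (simp add: entry)
    also have "(\<Sum>i\<in>UNIV. \<Sum>j\<in>UNIV. if b = i then if a = j then Rep_so_complex A $ j $ i / 2 else 0 else 0)
      = Rep_so_complex A $ a $ b / 2"
      by (subst sum.swap) (simp add: sum.delta')
    also have "(\<Sum>i\<in>UNIV. \<Sum>j\<in>UNIV. if b = j then if a = i then Rep_so_complex A $ j $ i / 2 else 0 else 0)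
      = Rep_so_complex A $ b $ a / 2"
      by (simp add: sum.delta')
    finally show ?thesis
      using skew[of b a] by simp
  qed
  have "Rep_so_complex A $ a $ b = Rep_so_complex
      (\<Sum>i\<in>UNIV. \<Sum>j\<in>UNIV. (Rep_so_complex A $ j $ i / 2) *\<^sub>L so_e i j) $ a $ b" for a b
    by (subst expand) (simp add: sum cscale_so_complex.rep_eq)
  then show ?thesis
    unfolding Rep_so_complex_inject[symmetric] vec_eq_iff by blast
qed


section \<open>The elements \<open>c\<^sub>q\<close>\<close>

definition ehat :: "'n::finite \<Rightarrow> 'n \<Rightarrow> 'n so_complex uea" where
  "ehat i j = uea_incl (so_e i j)
     + uea_scalar ((of_nat CARD('n) - 1) / 2) * (if i = j then 1 else 0)"

fun ehat_power :: "nat \<Rightarrow> 'n::finite \<Rightarrow> 'n \<Rightarrow> 'n so_complex uea" where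
  "ehat_power 0 i j = (if i = j then 1 else 0)"
| "ehat_power (Suc q) i j = (\<Sum>k\<in>UNIV. ehat i k * ehat_power q k j)"

definition chat :: "nat \<Rightarrow> 'n::finite so_complex uea" where
  "chat q = (\<Sum>i\<in>UNIV. ehat_power q i i)"

end

theory Submission
  imports Defs
begin

text \<open>
  Write \<open>E\<close> for the matrix of the \<open>ehat i j\<close>, so that \<open>ehat_power q\<close> is \<open>E^q\<close> and \<open>chat q\<close> is its
  trace \<open>c\<^sub>q\<close>.  Over a noncommutative ring the transpose of \<open>E^q\<close> is not the \<open>q\<close>-th power of the
  transpose of \<open>E\<close>, and the identity measures exactly this failure.  Two facts control it:
  the transpose of \<open>E\<close> is \<open>n - 1 - E\<close>, by skew-symmetry and the choice of the shift
  \<open>(n - 1) / 2\<close> (lemma \<open>ehat_swap\<close>), and every \<open>E^q\<close> commutes with \<open>so(n)\<close> like a tensor of rank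
  two (lemma \<open>commutator_ehat_power\<close>).  Let \<open>T\<^sub>q\<close> denote the transpose of \<open>E^q\<close>.  Moving the last
  factor of \<open>E^(q+1) = E^q E\<close> to the left costs a commutator whose contraction produces a trace,
  a transpose and multiples of \<open>E^q\<close> itself; the shift makes these multiples cancel, and what
  remains is, after transposing both sides,
  \<open>T\<^bsub>q+1\<^esub> = - E T\<^sub>q + c\<^sub>q - E^q\<close>
  (lemma \<open>transpose_ehat_power_Suc\<close>).  Since \<open>T\<^sub>0\<close> is the identity, the recursion unfolds to
  \<open>T\<^sub>q = (- E)^q + (\<Sum>p<q. (- E)^(q-1-p) (c\<^sub>p - E^p))\<close>.
  Transposition preserves the trace, so taking traces for odd \<open>q = 2 m + 1\<close> puts \<open>c\<^sub>q\<close> on the left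
  and \<open>- c\<^sub>q\<close> on the right, and the terms \<open>- (-1)^p c\<^bsub>2m\<^esub>\<close> add up to \<open>- c\<^bsub>2m\<^esub>\<close>.  The traces \<open>c\<^sub>p\<close> stay
  to the right of the powers of \<open>E\<close> throughout, which is the order of the factors in the theorem.
\<close>

section \<open>Commutation relations\<close>

abbreviation kronecker :: "'n \<Rightarrow> 'n \<Rightarrow> 'a::ring_1" where
  "kronecker i j \<equiv> (if i = j then 1 else 0)"

definition commutator :: "'a::ring_1 \<Rightarrow> 'a \<Rightarrow> 'a" where
  "commutator u v = u * v - v * u"

lemma commutator_mult: "commutator u (v * w) = commutator u v * w + v * commutator u w"
  by (simp add: commutator_def algebra_simps)

lemma commutator_sum: "commutator u (\<Sum>k\<in>A. f k) = (\<Sum>k\<in>A. commutator u (f k))"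
  by (simp add: commutator_def sum_distrib_left sum_distrib_right sum_subtractf)

lemma sum_kronecker_mult:
  fixes f :: "'n::finite \<Rightarrow> 'a::ring_1"
  shows "(\<Sum>m\<in>UNIV. kronecker k m * f m) = f k" "(\<Sum>m\<in>UNIV. f m * kronecker k m) = f k"
    "(\<Sum>m\<in>UNIV. kronecker m k * f m) = f k" "(\<Sum>m\<in>UNIV. f m * kronecker m k) = f k"
  by (simp_all add: if_distrib[of "\<lambda>x. x * _"] if_distrib[of "\<lambda>x. _ * x"] cong: if_cong)

lemma uea_scalar_of_nat: "uea_scalar (of_nat m) = of_nat m"
  by (induction m) (simp_all add: uea_scalar_hom)

lemma uea_scalar_diff: "uea_scalar (c - d) = uea_scalar c - uea_scalar d"
  by (simp add: eq_diff_eq flip: uea_scalar_hom(3))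

lemma uea_incl_zero: "uea_incl 0 = 0"
  using uea_incl_add[of 0 0] by simp

lemma uea_incl_diff: "uea_incl (x - y) = uea_incl x - uea_incl y"
  using uea_incl_add[of "x - y" y] by (simp add: algebra_simps)

lemma so_e_swap: "so_e i j + so_e j i = 0"
  by (rule so_complex_eqI)
    (simp add: Rep_so_complex_add_action so_e_action zero_so_complex.rep_eq)

lemma ehat_swap:
  "ehat i j = (of_nat CARD('n) - 1) * kronecker i j - ehat j (i :: 'n::finite)"
proof -
  have "uea_incl (so_e i j) + uea_incl (so_e j i) = 0"
    by (simp add: so_e_swap uea_incl_zero flip: uea_incl_add)
  moreover have "uea_scalar ((of_nat CARD('n) - 1) / 2) + uea_scalar ((of_nat CARD('n) - 1) / 2)
      = (of_nat CARD('n) - 1 :: 'n so_complex uea)"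
    by (simp add: uea_scalar_diff uea_scalar_of_nat uea_scalar_hom(2) flip: uea_scalar_hom(3))
  moreover have "ehat i j + ehat j i = (uea_incl (so_e i j) + uea_incl (so_e j i))
      + (uea_scalar ((of_nat CARD('n) - 1) / 2) + uea_scalar ((of_nat CARD('n) - 1) / 2))
        * kronecker i j"
    by (simp add: ehat_def)
  ultimately have "ehat i j + ehat j i = (of_nat CARD('n) - 1) * kronecker i j"
    by (simp only: add_0_left)
  then show ?thesis
    by (simp add: eq_diff_eq)
qed

text \<open>The scalar shift is central, so only the image of the Lie algebra element contributes.\<close>

lemma commutator_ehat: "commutator (ehat k l) u = commutator (uea_incl (so_e k l)) u"
  by (simp add: commutator_def ehat_def distrib_left distrib_right uea_scalar_commute)

lemma commutator_ehat_ehat: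
  "commutator (ehat k l) (ehat i j) =
     kronecker k i * ehat l j + kronecker k j * ehat i l
     - kronecker i l * ehat k j - kronecker l j * ehat i k"
proof -
  have kr: "uea_scalar (kronecker a b) = kronecker a b" for a b :: 'a
    by (simp add: uea_scalar_hom)
  have "commutator (ehat k l) (ehat i j) = uea_incl (lie (so_e k l) (so_e i j))"
    by (subst commutator_ehat)
      (simp add: commutator_def ehat_def distrib_left distrib_right uea_scalar_commute uea_incl_lie)
  \<comment> \<open>The four shifts that turn each \<open>so_e\<close> into an \<open>ehat\<close> cancel in pairs.\<close>
  also have "\<dots> = kronecker k i * ehat l j + kronecker k j * ehat i l
     - kronecker i l * ehat k j - kronecker l j * ehat i k"
    by (auto simp: so_e_bracket uea_incl_diff uea_incl_add uea_incl_cscale kr ehat_def)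
  finally show ?thesis .
qed

text \<open>
  A product of two matrices that transform like rank two tensors does so again: by the Leibniz
  rule, the terms of the commutator in which the contracted index is hit cancel.
\<close>

lemma commutator_ehat_power:
  "commutator (ehat k l) (ehat_power q i j) =
     kronecker k i * ehat_power q l j + kronecker k j * ehat_power q i l
     - kronecker i l * ehat_power q k j - kronecker l j * ehat_power q i k"
proof (induction q arbitrary: i j)
  case 0
  show ?case by (auto simp: commutator_def)
next
  case (Suc q)
  have kr: "u * (kronecker a b * v) = kronecker a b * (u * v)"
    for a b :: 'a and u v :: "'a so_complex uea"
    by simp
  have "commutator (ehat k l) (ehat_power (Suc q) i j)
    = (\<Sum>m\<in>UNIV. commutator (ehat k l) (ehat i m) * ehat_power q m j
                + ehat i m * commutator (ehat k l) (ehat_power q m j))"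
    by (simp add: commutator_sum commutator_mult)
  also have "\<dots> = (\<Sum>m\<in>UNIV. 
       kronecker k i * (ehat l m * ehat_power q m j) + kronecker k m * (ehat i l * ehat_power q m j)
     - kronecker i l * (ehat k m * ehat_power q m j) - kronecker l m * (ehat i k * ehat_power q m j)
     + (kronecker k m * (ehat i m * ehat_power q l j) + kronecker k j * (ehat i m * ehat_power q m l)
     - kronecker m l * (ehat i m * ehat_power q k j) - kronecker l j * (ehat i m * ehat_power q m k)))"
    by (intro sum.cong refl)
      (simp only: commutator_ehat_ehat Suc.IH distrib_left distrib_right left_diff_distrib
        right_diff_distrib kr mult.assoc)
  also have "\<dots> = kronecker k i * ehat_power (Suc q) l j + ehat i l * ehat_power q k j
     - kronecker i l * ehat_power (Suc q) k j - ehat i k * ehat_power q l j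
     + (ehat i k * ehat_power q l j + kronecker k j * ehat_power (Suc q) i l
     - ehat i l * ehat_power q k j - kronecker l j * ehat_power (Suc q) i k)"
    by (simp only: sum.distrib sum_subtractf sum_kronecker_mult ehat_power.simps
        flip: sum_distrib_left)
  finally show ?case by simp
qed

section \<open>Transposes of powers\<close>

lemma ehat_power_Suc_right:
  "ehat_power (Suc q) i j = (\<Sum>k\<in>UNIV. ehat_power q i k * ehat k j)"
proof (induction q arbitrary: i j)
  case 0
  show ?case by (simp only: ehat_power.simps sum_kronecker_mult)
next
  case (Suc q)
  have "ehat_power (Suc (Suc q)) i j = (\<Sum>m\<in>UNIV. \<Sum>k\<in>UNIV. ehat i m * (ehat_power q m k * ehat k j))"
    by (subst ehat_power.simps, subst Suc.IH) (simp only: sum_distrib_left)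
  also have "\<dots> = (\<Sum>k\<in>UNIV. ehat_power (Suc q) i k * ehat k j)"
    by (subst sum.swap) (simp add: sum_distrib_right mult.assoc)
  finally show ?case .
qed

text \<open>
  In the product \<open>E^q E\<close> the commutator that moves \<open>ehat k j\<close> to the left contributes
  \<open>- (n - 1) E^q\<close>, and replacing \<open>ehat k j\<close> by \<open>ehat j k\<close> contributes \<open>(n - 1) E^q\<close>; this is
  why \<open>(n - 1) / 2\<close> is the right shift.
\<close>

lemma transpose_ehat_power_Suc:
  "ehat_power (Suc q) i j =
     - (\<Sum>k\<in>UNIV. ehat j k * ehat_power q i k) + kronecker i j * chat q - ehat_power q j i"
  for i j :: "'n::finite"
proof -
  let ?N = "of_nat CARD('n) :: 'n so_complex uea"
  have "ehat_power (Suc q) i j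
    = (\<Sum>k\<in>UNIV. ehat k j * ehat_power q i k - commutator (ehat k j) (ehat_power q i k))"
    by (simp only: ehat_power_Suc_right commutator_def) simp
  also have "\<dots> = (\<Sum>k\<in>UNIV. (?N - 1) * (kronecker k j * ehat_power q i k)
      - ehat j k * ehat_power q i k
      - (kronecker k i * ehat_power q j k + ehat_power q i j
         - kronecker i j * ehat_power q k k - kronecker j k * ehat_power q i k))"
    by (intro sum.cong refl)
      (subst ehat_swap, simp only: commutator_ehat_power left_diff_distrib mult.assoc simp_thms
        if_True mult_1_left)
  also have "\<dots> = (?N - 1) * ehat_power q i j - (\<Sum>k\<in>UNIV. ehat j k * ehat_power q i k)
      - (ehat_power q j i + ?N * ehat_power q i j - kronecker i j * chat q - ehat_power q i j)"
    by (simp only: sum.distrib sum_subtractf sum_kronecker_mult chat_def sum_constant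
        flip: sum_distrib_left)
  finally show ?thesis by (simp add: algebra_simps)
qed

text \<open>
  Unfolding the recursion keeps every \<open>chat p\<close> on the right of a power of \<open>E\<close>.
\<close>

lemma transpose_ehat_power:
  "ehat_power q j i = (- 1) ^ q * ehat_power q i j
     + (\<Sum>p<q. (- 1) ^ (q - 1 - p) * (ehat_power (q - 1 - p) i j * chat p - ehat_power (q - 1) i j))"
proof (induction q arbitrary: i j)
  case 0
  show ?case by simp
next
  case (Suc q)
  have add: "(\<Sum>k\<in>UNIV. ehat i k * ehat_power m k j) = ehat_power (Suc m) i j" for m
    by simp
  have sgn: "u * ((- 1) ^ m * v) = (- 1) ^ m * (u * v)" for m and u v :: "'a so_complex uea"
    by (cases "even m") simp_all
  have step: "- ((- 1) ^ (q - 1 - p) *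
        (ehat_power (Suc (q - 1 - p)) i j * chat p - ehat_power (Suc (q - 1)) i j))
      = (- 1) ^ (q - p) * (ehat_power (q - p) i j * chat p - ehat_power q i j)" if "p < q" for p
  proof -
    have "q - p = Suc (q - 1 - p)" "q = Suc (q - 1)" using that by auto
    then show ?thesis by (metis mult_minus1 mult_minus_left power_Suc)
  qed
  have "(\<Sum>k\<in>UNIV. ehat i k * ehat_power q j k)
    = (\<Sum>k\<in>UNIV. (- 1) ^ q * (ehat i k * ehat_power q k j)
       + (\<Sum>p<q. (- 1) ^ (q - 1 - p) * ((ehat i k * ehat_power (q - 1 - p) k j) * chat p
            - ehat i k * ehat_power (q - 1) k j)))"
    by (intro sum.cong refl, subst Suc.IH)
      (simp only: distrib_left sum_distrib_left sgn right_diff_distrib mult.assoc)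
  also have "\<dots> = (- 1) ^ q * ehat_power (Suc q) i j
       + (\<Sum>p<q. (- 1) ^ (q - 1 - p) * (ehat_power (Suc (q - 1 - p)) i j * chat p
            - ehat_power (Suc (q - 1)) i j))"
    by (simp only: sum.distrib, subst sum.swap)
      (simp only: sum_subtractf add flip: sum_distrib_left sum_distrib_right)
  finally have product: "(\<Sum>k\<in>UNIV. ehat i k * ehat_power q j k) = \<dots>" .
  have "- (\<Sum>k\<in>UNIV. ehat i k * ehat_power q j k)
    = (- 1) ^ Suc q * ehat_power (Suc q) i j
       + (\<Sum>p<q. (- 1) ^ (q - p) * (ehat_power (q - p) i j * chat p - ehat_power q i j))"
    unfolding product minus_add_distrib sum_negf[symmetric]
    by (intro arg_cong2[of _ _ _ _ "(+)"] sum.cong refl step) simp_all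
  then show ?case
    by (subst transpose_ehat_power_Suc) (simp add: eq_commute[of j i] del: ehat_power.simps(2))
qed

lemma chat_eq_alternating_sum:
  "chat q = (- 1) ^ q * chat q
     + (\<Sum>p<q. (- 1) ^ (q - 1 - p) * (chat (q - 1 - p) * chat p - chat (q - 1)))"
proof -
  have "chat q = (\<Sum>i\<in>UNIV. (- 1) ^ q * ehat_power q i i
     + (\<Sum>p<q. (- 1) ^ (q - 1 - p) * (ehat_power (q - 1 - p) i i * chat p - ehat_power (q - 1) i i)))"
    unfolding chat_def[of q] by (intro sum.cong refl transpose_ehat_power)
  also have "\<dots> = (- 1) ^ q * chat q
     + (\<Sum>p<q. (- 1) ^ (q - 1 - p) * (chat (q - 1 - p) * chat p - chat (q - 1)))"
    by (simp only: sum.distrib, subst sum.swap)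
      (simp only: sum_subtractf chat_def flip: sum_distrib_left sum_distrib_right)
  finally show ?thesis .
qed

section \<open>The odd Casimir elements\<close>

theorem corollary3p5:
  fixes q :: nat
  assumes "CARD('n::finite) \<ge> 2"
  shows "2 * (chat (2 * q + 1) :: 'n so_complex uea) =
    - chat (2 * q) + (\<Sum>p = 0..2 * q. (- 1) ^ p * chat (2 * q - p) * chat p)"
proof -
  let ?c = "chat :: nat \<Rightarrow> 'n so_complex uea"
  have alternating: "(\<Sum>p<2 * q + 1. (- 1) ^ p * ?c (2 * q)) = ?c (2 * q)"
  proof -
    have "(\<Sum>p<2 * q + 1. (- 1) ^ p) = (1 :: 'n so_complex uea)"
      by (induction q) simp_all
    then show ?thesis by (simp only: mult_1_left flip: sum_distrib_right)
  qed
  have "?c (2 * q + 1) = - ?c (2 * q + 1)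
    + (\<Sum>p<2 * q + 1. (- 1) ^ (2 * q - p) * (?c (2 * q - p) * ?c p - ?c (2 * q)))"
    using chat_eq_alternating_sum[of "2 * q + 1", where 'a='n] by simp
  also have "(\<Sum>p<2 * q + 1. (- 1) ^ (2 * q - p) * (?c (2 * q - p) * ?c p - ?c (2 * q)))
    = (\<Sum>p<2 * q + 1. (- 1) ^ p * ?c (2 * q - p) * ?c p - (- 1) ^ p * ?c (2 * q))"
  proof (intro sum.cong refl)
    fix p assume "p \<in> {..<2 * q + 1}"
    then have "(- 1) ^ (2 * q - p) = ((- 1) ^ p :: 'n so_complex uea)"
      by (cases "even p") auto
    then show "(- 1) ^ (2 * q - p) * (?c (2 * q - p) * ?c p - ?c (2 * q))
      = (- 1) ^ p * ?c (2 * q - p) * ?c p - (- 1) ^ p * ?c (2 * q)"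
      by (simp add: right_diff_distrib mult.assoc)
  qed
  also have "\<dots> = (\<Sum>p = 0..2 * q. (- 1) ^ p * ?c (2 * q - p) * ?c p) - ?c (2 * q)"
    unfolding sum_subtractf alternating by (simp add: atLeast0AtMost lessThan_Suc_atMost)
  finally show ?thesis
    by (simp add: algebra_simps mult_2 eq_diff_eq)
qed

end
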